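(* For every integer $k\ge2$, $$\frac{k-1}{k}<\frac{\tan\frac{\pi}{2(k+1)}}{\tan\frac{\pi}{2k}}<\frac{k+1}{k+2},$$ and for every integer $n\ge3$, $$\frac{1}{n-1}<\tan\frac{\pi}{2n}<\frac{3}{n+1},$$ $$\frac{2(n-1)}{n(n-2)}<\tan\frac{\pi}{n}<\frac{6(n+1)}{(n+4)(n-2)},$$ $$\frac{(n-2)(n+4)}{n^2+2n+10}<\cos\frac{\pi}{n}<\frac{n(n-2)}{n^2-2n+2},$$ $$\frac{2(n+1)^2}{(n-1)(n^2+2n+10)}<\sin\frac{\pi}{n}<\frac{6(n-1)^2}{(n+1)(n^2-2n+2)}.$$ Consequently, as $n\to\infty$ through the integers, $$\tan\frac{\pi}{n}=\frac{2(n-1)}{n(n-2)}+O\left(\frac1n\right),\qquad \cos\frac{\pi}{n}=\frac{(n-2)(n+4)}{n^2+2n+10}+O\left(\frac{1}{n^2}\right),\qquad \sin\frac{\pi}{n}=\frac{2(n+1)^2}{(n-1)(n^2+2n+10)}+O\left(\frac1n\right).$$ *)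

theory Defs
  imports Complex_Main "HOL-Library.Landau_Symbols"
begin

end

theory Submission
  imports Defs "HOL-Real_Asymp.Real_Asymp"
begin

text \<open>
  With \<open>y = \<pi>/(2k)\<close>, the two bounds on the ratio of tangents say that \<open>(k + 1) tan y\<close> decreases and
  \<open>(k - 1) tan y\<close> increases in \<open>k\<close>. The first holds because \<open>tan y / y\<close> is increasing, the second
  because \<open>(\<pi>/2 - y) tan y / y\<close> is decreasing on \<open>(0, \<pi>/4]\<close>; by differentiation the latter amounts
  to \<open>sin u > u (\<pi> - u) / \<pi>\<close> with \<open>u = 2y\<close>. Both products start from \<open>tan (\<pi>/4) = 1\<close> at \<open>k = 2\<close>, which gives
  the bounds on \<open>tan (\<pi>/(2n))\<close>; the others follow by expressing \<open>tan\<close>, \<open>cos\<close> and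
  \<open>sin\<close> of \<open>\<pi>/n\<close> through \<open>tan (\<pi>/(2n))\<close>.
\<close>

text \<open>Equivalent to pi/2 < sqrt 3, which follows once cos is negative at sqrt 3: Taylor
  expansion with fourth-order remainder gives at most 1 - 3/2 + 9/24 = -1/8 there.\<close>

lemma pi_squared_less_12: "pi\<^sup>2 < 12"
proof (rule ccontr)
  assume "\<not> ?thesis"
  then have "sqrt 3 \<le> pi / 2"
    by (intro real_le_lsqrt) (simp_all add: power_divide)
  then have "cos (sqrt 3) \<ge> 0"
    using pi_gt_zero by (intro cos_ge_zero order_trans[of "- (pi / 2)" 0 "sqrt 3"]) simp_all
  obtain t where "cos (sqrt 3) = (\<Sum>m<4. cos_coeff m * sqrt 3 ^ m) + cos (t + 1/2 * real 4 * pi) / fact 4 * sqrt 3 ^ 4"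
    using Maclaurin_cos_expansion[of "sqrt 3" 4] by blast
  moreover have "sqrt 3 ^ 4 = 9"
    using real_sqrt_pow2[of 3] by (simp add: power4_eq_xxxx)
  ultimately have "cos (sqrt 3) = 3 / 8 * cos t - 1 / 2"
    by (simp add: eval_nat_numeral cos_coeff_Suc sin_coeff_Suc)
  with \<open>cos (sqrt 3) \<ge> 0\<close> show False
    using cos_le_one[of t] by linarith
qed

lemma sin_ge_cubic:
  assumes "x > (0::real)"
  shows "x - x ^ 3 / 6 \<le> sin x"
proof -
  obtain t where "sin x = (\<Sum>m<3. sin_coeff m * x ^ m) + sin (t + 1/2 * real 3 * pi) / fact 3 * x ^ 3"
    using Maclaurin_sin_expansion[of x 3] by blast
  moreover have "(\<Sum>m<3. sin_coeff m * x ^ m) = x"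
    by (simp add: eval_nat_numeral sin_coeff_def)
  moreover have "- 1 / 6 * x ^ 3 \<le> sin (t + 1/2 * real 3 * pi) / fact 3 * x ^ 3"
    using assms by (intro mult_right_mono) (simp_all add: fact_numeral)
  ultimately show ?thesis by simp
qed

text \<open>The parabola is u - u^2/pi, which lies below the cubic u - u^3/6 exactly when u pi < 6.
  For u at most pi/2 this is where pi^2 < 12 enters.\<close>

lemma sin_gt_parabola:
  assumes "0 < u" "u \<le> pi / 2"
  shows "u * (pi - u) / pi < sin u"
proof -
  have "u * pi \<le> pi\<^sup>2 / 2"
    using assms by (simp add: power2_eq_square)
  also have "\<dots> < 6" using pi_squared_less_12 by simp
  finally have "u ^ 2 * (u * pi) < u ^ 2 * 6"
    using assms by (intro mult_strict_left_mono) auto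
  then have "u * (pi - u) / pi < u - u ^ 3 / 6"
    by (simp add: field_simps power2_eq_square power3_eq_cube)
  also have "\<dots> \<le> sin u" by (rule sin_ge_cubic) fact
  finally show ?thesis .
qed

text \<open>The sign of the derivative is that of z - sin z cos z, which is positive because sin z
  cos z < sin z \<le> z.\<close>

lemma tan_over_id_less:
  fixes x y :: real
  assumes "0 < x" "x < y" "y < pi / 2"
  shows "tan x / x < tan y / y"
proof (rule DERIV_pos_imp_increasing[OF \<open>x < y\<close>])
  fix z assume "x \<le> z" "z \<le> y"
  then have z: "0 < z" "z < pi / 2" using assms by auto
  then have c: "cos z > 0" by (intro cos_gt_zero)
  have "cos z < 1"
    using cos_monotone_0_pi[of 0 z] z by simp
  then have "sin z * cos z < sin z"
    using sin_gt_zero2[of z] z by simp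
  also have "\<dots> \<le> z" using z by (intro sin_x_le_x) simp
  finally have sc: "sin z * cos z < z" .
  have "((\<lambda>z. tan z / z) has_real_derivative (z - sin z * cos z) / (z * cos z)\<^sup>2) (at z)"
    by (rule DERIV_cong[OF DERIV_divide[OF DERIV_tan DERIV_ident]])
      (use z c in \<open>simp_all add: tan_def field_simps power2_eq_square\<close>)
  moreover have "(z - sin z * cos z) / (z * cos z)\<^sup>2 > 0"
    using sc z c by simp
  ultimately show "\<exists>d. ((\<lambda>z. tan z / z) has_real_derivative d) (at z) \<and> 0 < d" by blast
qed

lemma complement_tan_over_id_less:
  fixes x y :: real
  assumes "0 < x" "x < y" "y \<le> pi / 4"
  shows "(pi / 2 - y) * tan y / y < (pi / 2 - x) * tan x / x"
proof (rule DERIV_neg_imp_decreasing[OF \<open>x < y\<close>])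
  fix z assume "x \<le> z" "z \<le> y"
  then have z: "0 < z" "z \<le> pi / 4" using assms by auto
  then have c: "cos z > 0" by (intro cos_gt_zero) auto
  \<comment> \<open>The bound z \<le> pi/4 is what puts 2z in the range of
    \<open>sin_gt_parabola\<close>; the double-angle formula then makes the numerator of the
    derivative negative.\<close>
  have "2 * z * (pi - 2 * z) / pi < sin (2 * z)"
    using z by (intro sin_gt_parabola) auto
  then have neg: "(pi / 2 - z) * z - pi / 2 * (sin z * cos z) < 0"
    unfolding sin_double by (simp add: field_simps)
  have "((\<lambda>z. (pi / 2 - z) * tan z / z) has_real_derivative
      ((pi / 2 - z) * z - pi / 2 * (sin z * cos z)) / (z * cos z)\<^sup>2) (at z)"
    by (rule DERIV_cong[OF DERIV_divide[OF DERIV_mult[OF DERIV_diff[OF DERIV_const DERIV_ident] DERIV_tan] DERIV_ident]])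
      (use z c in \<open>simp_all add: tan_def field_simps power2_eq_square\<close>)
  moreover have "((pi / 2 - z) * z - pi / 2 * (sin z * cos z)) / (z * cos z)\<^sup>2 < 0"
    using neg z c by (intro divide_neg_pos) auto
  ultimately show "\<exists>d. ((\<lambda>z. (pi / 2 - z) * tan z / z) has_real_derivative d) (at z) \<and> d < 0"
    by blast
qed


lemma tan_half_angle_pi_bounds:
  fixes x :: real
  assumes "x \<ge> 2"
  shows "tan (pi / (2 * (x + 1))) / tan (pi / (2 * x)) < (x + 1) / (x + 2)"
    and "(x - 1) / x < tan (pi / (2 * (x + 1))) / tan (pi / (2 * x))"
proof -
  define y z where "y = pi / (2 * (x + 1))" and "z = pi / (2 * x)"
  have yz: "0 < y" "y < z" "z \<le> pi / 4"
    using assms by (simp_all add: y_def z_def field_simps)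
  then have tz: "tan z > 0" by (intro tan_gt_zero) auto
  have "tan y / y < tan z / z"
    using yz by (intro tan_over_id_less) auto
  then have "tan y / tan z < y / z"
    using yz tz by (simp add: field_simps)
  also have "\<dots> = x / (x + 1)"
    using assms by (simp add: y_def z_def divide_simps)
  \<comment> \<open>Monotonicity of tan y / y gives the sharper bound x/(x+1); it is relaxed here to
    the stated one.\<close>
  also have "\<dots> < (x + 1) / (x + 2)"
    using assms by (simp add: field_simps)
  finally show "tan y / tan z < (x + 1) / (x + 2)" .
  have "(pi / 2 - z) * tan z / z < (pi / 2 - y) * tan y / y"
    using yz by (intro complement_tan_over_id_less) auto
  \<comment> \<open>The complement factor pi/2 - y was chosen for these quotients: they turn the
    monotonicity into a comparison of (x - 1) tan z with x tan y.\<close>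
  moreover have "(pi / 2 - z) / z = x - 1" "(pi / 2 - y) / y = x"
  proof -
    have "pi / 2 = x * z" "pi / 2 = (x + 1) * y"
      using assms by (simp_all add: y_def z_def divide_simps)
    then show "(pi / 2 - z) / z = x - 1" "(pi / 2 - y) / y = x"
      using yz by (simp_all add: divide_simps algebra_simps)
  qed
  ultimately have "(x - 1) * tan z < x * tan y"
    by (metis times_divide_eq_left)
  then show "(x - 1) / x < tan y / tan z"
    using assms tz by (simp add: field_simps)
qed

lemma tan_pi_half_bounds:
  assumes "n \<ge> 3"
  shows "1 / (real n - 1) < tan (pi / (2 * real n))"
    and "tan (pi / (2 * real n)) < 3 / (real n + 1)"
proof -
  define t where "t = (\<lambda>n. tan (pi / (2 * real n)))"
  have rec: "(real m - 1) * t m < real m * t (Suc m) \<and> (real m + 2) * t (Suc m) < (real m + 1) * t m"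
    if "m \<ge> 2" for m
  proof -
    have "t m > 0"
      using that unfolding t_def by (intro tan_gt_zero) (auto simp: field_simps)
    then show ?thesis
      using tan_half_angle_pi_bounds[of "real m"] that
      by (simp add: t_def field_simps)
  qed
  \<comment> \<open>Both bounds are equalities at m = 2, where t is tan (pi/4) = 1, so the induction
    carries only non-strict inequalities.\<close>
  have le: "1 \<le> (real m - 1) * t m \<and> (real m + 1) * t m \<le> 3" if "m \<ge> 2" for m
    using that
  proof (induction m rule: dec_induct)
    case base
    then show ?case by (simp add: t_def tan_45)
  next
    case (step m)
    then show ?case using rec[of m] by (simp add: add.commute)
  qed
  \<comment> \<open>One further application of the strict recurrence, from n - 1 to n, makes the
    bounds strict.\<close>
  obtain m where m: "n = Suc m" "m \<ge> 2"
    using assms by (cases n) auto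
  then have "1 < (real n - 1) * t n" "(real n + 1) * t n < 3"
    using rec[of m] le[of m] by (simp_all add: add.commute)
  then show "1 / (real n - 1) < tan (pi / (2 * real n))"
    and "tan (pi / (2 * real n)) < 3 / (real n + 1)"
    using assms by (simp_all add: t_def field_simps)
qed

lemma one_plus_tan_squared:
  assumes "cos (x::real) \<noteq> 0"
  shows "1 + (tan x)\<^sup>2 = 1 / (cos x)\<^sup>2"
  using tan_sec[OF assms] by (simp add: inverse_eq_divide power_divide)

lemma cos_double_tan:
  assumes "cos (x::real) \<noteq> 0"
  shows "cos (2 * x) = (1 - (tan x)\<^sup>2) / (1 + (tan x)\<^sup>2)"
proof -
  have "(1 - (tan x)\<^sup>2) * (cos x)\<^sup>2 = cos (2 * x)"
    using assms unfolding cos_double tan_def by (simp add: field_simps power2_eq_square)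
  then show ?thesis using assms by (simp add: one_plus_tan_squared)
qed

lemma sin_double_tan:
  assumes "cos (x::real) \<noteq> 0"
  shows "sin (2 * x) = 2 * tan x / (1 + (tan x)\<^sup>2)"
proof -
  have "2 * tan x * (cos x)\<^sup>2 = sin (2 * x)"
    using assms unfolding sin_double tan_def by (simp add: power2_eq_square)
  then show ?thesis using assms by (simp add: one_plus_tan_squared)
qed

text \<open>With t the tangent of the half angle, these are the formulas for tan, cos and sin. In
  the sine formula numerator and denominator both grow with t, so they are bounded separately at
  opposite endpoints; this produces the mixture of a and b.\<close>

lemma half_angle_bounds:
  fixes a t b :: real
  assumes "0 < a" "a < t" "t < b" "b < 1"
  shows "2 * a / (1 - a\<^sup>2) < 2 * t / (1 - t\<^sup>2)" "2 * t / (1 - t\<^sup>2) < 2 * b / (1 - b\<^sup>2)"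
    and "(1 - b\<^sup>2) / (1 + b\<^sup>2) < (1 - t\<^sup>2) / (1 + t\<^sup>2)" "(1 - t\<^sup>2) / (1 + t\<^sup>2) < (1 - a\<^sup>2) / (1 + a\<^sup>2)"
    and "2 * a / (1 + b\<^sup>2) < 2 * t / (1 + t\<^sup>2)" "2 * t / (1 + t\<^sup>2) < 2 * b / (1 + a\<^sup>2)"
proof -
  have sq: "a\<^sup>2 < t\<^sup>2" "t\<^sup>2 < b\<^sup>2" "b\<^sup>2 < 1" "0 < a\<^sup>2"
    using assms by (auto intro!: power_strict_mono simp: power_less_one_iff)
  show "2 * a / (1 - a\<^sup>2) < 2 * t / (1 - t\<^sup>2)" "2 * t / (1 - t\<^sup>2) < 2 * b / (1 - b\<^sup>2)"
    "(1 - b\<^sup>2) / (1 + b\<^sup>2) < (1 - t\<^sup>2) / (1 + t\<^sup>2)" "(1 - t\<^sup>2) / (1 + t\<^sup>2) < (1 - a\<^sup>2) / (1 + a\<^sup>2)"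
    "2 * a / (1 + b\<^sup>2) < 2 * t / (1 + t\<^sup>2)" "2 * t / (1 + t\<^sup>2) < 2 * b / (1 + a\<^sup>2)"
    using sq assms by (auto intro!: frac_less frac_less2 add_pos_pos)
qed

lemma trig_pi_over_bounds:
  assumes "n \<ge> 3"
  defines "x \<equiv> real n"
  shows "2 * (x - 1) / (x * (x - 2)) < tan (pi / x)"
    and "tan (pi / x) < 6 * (x + 1) / ((x + 4) * (x - 2))"
    and "(x - 2) * (x + 4) / (x\<^sup>2 + 2 * x + 10) < cos (pi / x)"
    and "cos (pi / x) < x * (x - 2) / (x\<^sup>2 - 2 * x + 2)"
    and "2 * (x + 1)\<^sup>2 / ((x - 1) * (x\<^sup>2 + 2 * x + 10)) < sin (pi / x)"
    and "sin (pi / x) < 6 * (x - 1)\<^sup>2 / ((x + 1) * (x\<^sup>2 - 2 * x + 2))"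
proof -
  define y where "y = pi / (2 * x)"
  define a b where "a = 1 / (x - 1)" and "b = 3 / (x + 1)"
  have x: "x \<ge> 3" using assms by simp
  have y: "2 * y = pi / x" by (simp add: y_def)
  have "0 < y" "2 * y < pi / 2"
    using x by (simp_all add: y_def field_simps)
  then have c: "cos y \<noteq> 0" "cos (2 * y) \<noteq> 0"
    using cos_gt_zero[of y] cos_gt_zero[of "2 * y"] by auto
  have bounds: "0 < a" "a < tan y" "tan y < b" "b < 1"
    using x tan_pi_half_bounds[OF assms(1)] by (simp_all add: a_def b_def y_def x_def)
  \<comment> \<open>Completing squares exposes p = x - 1 and q = x + 1, the natural variables
    because a = 1/p and b = 3/q.\<close>
  have sq: "x\<^sup>2 - 2 * x + 2 = (x - 1)\<^sup>2 + 1" "x\<^sup>2 + 2 * x + 10 = (x + 1)\<^sup>2 + 9"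
    "x * (x - 2) = (x - 1)\<^sup>2 - 1" "(x - 2) * (x + 4) = (x + 1)\<^sup>2 - 9"
    "(x + 4) * (x - 2) = (x + 1)\<^sup>2 - 9"
    by (simp_all add: power2_eq_square algebra_simps)
  define p q where "p = x - 1" and "q = x + 1"
  have pq: "p > 1" "q > 3" using x by (simp_all add: p_def q_def)
  have nz: "p\<^sup>2 > 1" "q\<^sup>2 > 9"
    using pq power_strict_mono[of 3 q 2] by (simp_all add: one_less_power)
  have a: "2 * a / (1 - a\<^sup>2) = 2 * (x - 1) / (x * (x - 2))"
    "(1 - a\<^sup>2) / (1 + a\<^sup>2) = x * (x - 2) / (x\<^sup>2 - 2 * x + 2)"
    unfolding sq a_def b_def p_def[symmetric] q_def[symmetric] using pq nz
    by (simp_all add: divide_simps add_pos_pos; simp add: power2_eq_square algebra_simps)+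
  have b: "2 * b / (1 - b\<^sup>2) = 6 * (x + 1) / ((x + 4) * (x - 2))"
    "(1 - b\<^sup>2) / (1 + b\<^sup>2) = (x - 2) * (x + 4) / (x\<^sup>2 + 2 * x + 10)"
    unfolding sq a_def b_def p_def[symmetric] q_def[symmetric] using pq nz
    by (simp_all add: divide_simps add_pos_pos; simp add: power2_eq_square algebra_simps)+
  have ab: "2 * a / (1 + b\<^sup>2) = 2 * (x + 1)\<^sup>2 / ((x - 1) * (x\<^sup>2 + 2 * x + 10))"
    "2 * b / (1 + a\<^sup>2) = 6 * (x - 1)\<^sup>2 / ((x + 1) * (x\<^sup>2 - 2 * x + 2))"
    unfolding sq a_def b_def p_def[symmetric] q_def[symmetric] using pq nz
    by (simp_all add: divide_simps add_pos_pos; simp add: power2_eq_square algebra_simps)+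
  \<comment> \<open>Folding recognises the rational functions of tan y as tan, cos and sin of 2y =
    pi/x; unfolding puts the outer bounds into closed form.\<close>
  note bounds' = half_angle_bounds[OF bounds, folded tan_double[OF c] cos_double_tan[OF c(1)]
    sin_double_tan[OF c(1)], unfolded a b ab y]
  show "2 * (x - 1) / (x * (x - 2)) < tan (pi / x)"
    and "tan (pi / x) < 6 * (x + 1) / ((x + 4) * (x - 2))"
    and "(x - 2) * (x + 4) / (x\<^sup>2 + 2 * x + 10) < cos (pi / x)"
    and "cos (pi / x) < x * (x - 2) / (x\<^sup>2 - 2 * x + 2)"
    and "2 * (x + 1)\<^sup>2 / ((x - 1) * (x\<^sup>2 + 2 * x + 10)) < sin (pi / x)"
    and "sin (pi / x) < 6 * (x - 1)\<^sup>2 / ((x + 1) * (x\<^sup>2 - 2 * x + 2))"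
    by (fact bounds')+
qed

theorem mainTheorem13:
  "(\<forall>k::nat. k \<ge> 2 \<longrightarrow>
      (real k - 1) / real k < tan (pi / (2 * (real k + 1))) / tan (pi / (2 * real k)) \<and>
      tan (pi / (2 * (real k + 1))) / tan (pi / (2 * real k)) < (real k + 1) / (real k + 2)) \<and>
   (\<forall>n::nat. n \<ge> 3 \<longrightarrow>
      (1 / (real n - 1) < tan (pi / (2 * real n)) \<and>
       tan (pi / (2 * real n)) < 3 / (real n + 1)) \<and>
      (2 * (real n - 1) / (real n * (real n - 2)) < tan (pi / real n) \<and>
       tan (pi / real n) < 6 * (real n + 1) / ((real n + 4) * (real n - 2))) \<and>
      ((real n - 2) * (real n + 4) / ((real n)^2 + 2 * real n + 10) < cos (pi / real n) \<and>
       cos (pi / real n) < real n * (real n - 2) / ((real n)^2 - 2 * real n + 2)) \<and>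
      (2 * (real n + 1)^2 / ((real n - 1) * ((real n)^2 + 2 * real n + 10)) < sin (pi / real n) \<and>
       sin (pi / real n) < 6 * (real n - 1)^2 / ((real n + 1) * ((real n)^2 - 2 * real n + 2)))) \<and>
   (\<lambda>n::nat. tan (pi / real n) - 2 * (real n - 1) / (real n * (real n - 2)))
      \<in> O(\<lambda>n. 1 / real n) \<and>
   (\<lambda>n::nat. cos (pi / real n) - (real n - 2) * (real n + 4) / ((real n)^2 + 2 * real n + 10))
      \<in> O(\<lambda>n. 1 / (real n)^2) \<and>
   (\<lambda>n::nat. sin (pi / real n)
        - 2 * (real n + 1)^2 / ((real n - 1) * ((real n)^2 + 2 * real n + 10)))
      \<in> O(\<lambda>n. 1 / real n)"
proof (intro conjI allI impI)
  fix k :: nat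
  assume "k \<ge> 2"
  then have "real k \<ge> 2" by simp
  then show "(real k - 1) / real k < tan (pi / (2 * (real k + 1))) / tan (pi / (2 * real k))"
    and "tan (pi / (2 * (real k + 1))) / tan (pi / (2 * real k)) < (real k + 1) / (real k + 2)"
    by (fact tan_half_angle_pi_bounds)+
\<comment> \<open>The O-estimates come from direct asymptotic expansion, not from the bounds: for
  tan and sin both terms are O(1/n), for cos both are 1 + O(1/n^2).\<close>
qed (fact tan_pi_half_bounds trig_pi_over_bounds | real_asymp)+

end
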